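(* Let $n\ge 3$ be odd. Let $R_n$ be the Galois ring of characteristic $4$ and cardinality $4^n$ with Teichmüller set $\Gamma(R_n)$, viewed as the field $(\Gamma(R_n),\oplus,\cdot)$ of order $2^n$, let $\beta$ be a generator of $\Gamma(R_n)^*$, let $f:\Gamma(R_n)\to\Gamma(R_n)$, and let $\mathcal{C}_f$ be the code over $\mathbb{Z}_4$ with parity check matrix \[\begin{bmatrix}1 & 1 & 1 & \cdots & 1\\ 2\sqrt{f(0)} & 1+2\sqrt{f(1)} & \beta+2\sqrt{f(\beta)} & \cdots & \beta^{2^n-2}+2\sqrt{f(\beta^{2^n-2})}\end{bmatrix}.\] Then the minimum Lee distance of $\mathcal{C}_f$ is $4$ or $6$, and it equals $6$ if and only if $f$ is planar.
   Context: The unit group of $R_n$ contains a cyclic subgroup $\Gamma(R_n)^*$ of order $2^n-1$; $\Gamma(R_n)=\Gamma(R_n)^*\cup\{0\}$ is the Teichmüller set, which is a field of order $2^n$ under the multiplication of $R_n$ and the addition $x\oplus y=x+y+2\sqrt{xy}$, where $\sqrt{z}$ is the unique square root of $z$ in $\Gamma(R_n)$. The function $f$ is planar if for every nonzero $\epsilon\in\Gamma(R_n)$ the map $x\mapsto f(x\oplus\epsilon)\oplus f(x)\oplus\epsilon x$ is a permutation of $\Gamma(R_n)$. The Lee weights of $0,1,2,3\in\mathbb{Z}_4$ are $0,1,2,1$; the Lee weight of a vector is the sum of the Lee weights of its entries and the Lee distance of two vectors is the Lee weight of their difference. *)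

theory Defs
  imports
    "HOL-Library.Numeral_Type"
    "HOL-Library.FuncSet"
    "HOL-Computational_Algebra.Primes"
    "Jordan_Normal_Form.Matrix"
begin

section \<open>Galois rings and Teichmueller sets\<close>

text \<open>
  A Galois ring is a finite commutative ring with identity whose zero divisors, together with
  \<open>0\<close>, form the principal ideal generated by \<open>p \<cdot> 1\<close> for some prime \<open>p\<close>.
  It is determined up to isomorphism by its characteristic and its cardinality.
  The element \<open>0\<close> is on the left-hand side below (take \<open>y = 1\<close>).
\<close>

definition galois_ring :: "'r::{comm_ring_1,finite} itself \<Rightarrow> bool" where
  "galois_ring _ \<longleftrightarrow>
     (\<exists>p::nat. prime p \<and> {x::'r. \<exists>y. y \<noteq> 0 \<and> x * y = 0} = range (\<lambda>y. of_nat p * y))"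

text \<open>In a finite group every power is a power with natural exponent.\<close>

definition cyclic_generator :: "'r::comm_ring_1 \<Rightarrow> 'r set \<Rightarrow> bool" where
  "cyclic_generator g G \<longleftrightarrow> G = range (\<lambda>i::nat. g ^ i)"

text \<open>
  \<open>G\<close> is a cyclic subgroup of order \<open>2 ^ n - 1\<close> of the unit group.  In the Galois ring of
  characteristic \<open>4\<close> and cardinality \<open>4 ^ n\<close> the unit group has order \<open>2 ^ n * (2 ^ n - 1)\<close>,
  so \<open>G\<close> is unique; the Teichmueller set is \<open>insert 0 G\<close>.
\<close>

definition teich_group :: "nat \<Rightarrow> 'r::comm_ring_1 set \<Rightarrow> bool" where
  "teich_group n G \<longleftrightarrow>
     G \<subseteq> {x. x dvd 1} \<and> 1 \<in> G \<and>
     (\<forall>x\<in>G. \<forall>y\<in>G. x * y \<in> G) \<and> (\<forall>x\<in>G. \<exists>y\<in>G. x * y = 1) \<and>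
     (\<exists>g\<in>G. cyclic_generator g G) \<and> card G = 2 ^ n - 1"

text \<open>In the remaining definitions \<open>T\<close> is the Teichmueller set.\<close>

definition teich_sqrt :: "'r::comm_ring_1 set \<Rightarrow> 'r \<Rightarrow> 'r" where
  "teich_sqrt T z = (THE y. y \<in> T \<and> y ^ 2 = z)"

definition teich_add :: "'r::comm_ring_1 set \<Rightarrow> 'r \<Rightarrow> 'r \<Rightarrow> 'r" where
  "teich_add T x y = x + y + 2 * teich_sqrt T (x * y)"

definition planar :: "'r::comm_ring_1 set \<Rightarrow> ('r \<Rightarrow> 'r) \<Rightarrow> bool" where
  "planar T f \<longleftrightarrow>
     (\<forall>e\<in>T - {0}.
        bij_betw (\<lambda>x. teich_add T (teich_add T (f (teich_add T x e)) (f x)) (e * x)) T T)"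


section \<open>Codes over the integers modulo 4\<close>

text \<open>
  The numeral type \<open>4\<close> is the ring of integers modulo \<open>4\<close>, and \<open>Rep_bit0\<close> gives the
  representative in \<open>{0..<4}\<close>.  In characteristic \<open>4\<close>, \<open>z4_embed\<close> is the embedding of
  this ring as the prime subring.
\<close>

definition z4_embed :: "4 \<Rightarrow> 'r::comm_ring_1" where
  "z4_embed c = of_int (Rep_bit0 c)"

definition code_of_parity_check :: "'r::comm_ring_1 mat \<Rightarrow> 4 vec set" where
  "code_of_parity_check H =
     {c \<in> carrier_vec (dim_col H). H *\<^sub>v map_vec z4_embed c = 0\<^sub>v (dim_row H)}"

definition lee_weight_elem :: "4 \<Rightarrow> nat" where
  "lee_weight_elem c = (if c = 0 then 0 else if c = 2 then 2 else 1)"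

definition lee_weight :: "4 vec \<Rightarrow> nat" where
  "lee_weight v = (\<Sum>i<dim_vec v. lee_weight_elem (v $ i))"

definition lee_dist :: "4 vec \<Rightarrow> 4 vec \<Rightarrow> nat" where
  "lee_dist u v = lee_weight (u - v)"

definition min_lee_dist :: "4 vec set \<Rightarrow> nat" where
  "min_lee_dist C = Min {lee_dist u v | u v. u \<in> C \<and> v \<in> C \<and> u \<noteq> v}"


section \<open>The code of a function on the Teichmueller set\<close>

text \<open>The columns are indexed by \<open>0, 1, \<beta>, \<beta>\<^sup>2, \<dots>\<close>, in this order.\<close>

definition teich_point :: "'r::comm_ring_1 \<Rightarrow> nat \<Rightarrow> 'r" where
  "teich_point \<beta> j = (case j of 0 \<Rightarrow> 0 | Suc i \<Rightarrow> \<beta> ^ i)"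

definition parity_check_matrix ::
    "nat \<Rightarrow> 'r::comm_ring_1 set \<Rightarrow> 'r \<Rightarrow> ('r \<Rightarrow> 'r) \<Rightarrow> 'r mat" where
  "parity_check_matrix n T \<beta> f =
     mat 2 (2 ^ n) (\<lambda>(i, j).
       if i = 0 then 1
       else teich_point \<beta> j + 2 * teich_sqrt T (f (teich_point \<beta> j)))"

definition function_code ::
    "nat \<Rightarrow> 'r::comm_ring_1 set \<Rightarrow> 'r \<Rightarrow> ('r \<Rightarrow> 'r) \<Rightarrow> 4 vec set" where
  "function_code n T \<beta> f = code_of_parity_check (parity_check_matrix n T \<beta> f)"

end

theory Submission
  imports Defs Complex_Main
begin

text \<open>
  Congruence modulo \<open>2\<close> is written \<open>2 * r = 2 * s\<close> throughout, and
  \<open>h x = x + 2 \<surd>(f x)\<close> is the second entry of the column at \<open>x\<close>.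
  Code words have even Lee weight, none has weight \<open>2\<close>, and weight at most \<open>6\<close> is attained by
  solving \<open>h x + 2 (h y) = h u + h v + h w\<close>.  A word of weight \<open>4\<close> amounts to a nontrivial solution of
  \<open>h x - h y = h z - h w\<close> or of \<open>h x + h y + h z + h w = 0\<close>.  Squaring modulo \<open>2\<close> shows that
  the first equation has none iff \<open>f\<close> is planar.  In that case each character sum
  \<open>S = \<Sum>x. \<chi> (c * h x)\<close> with \<open>\<chi>\<close> nontrivial on \<open>2 c R\<close> satisfies \<open>\<bar>S\<bar>\<^sup>2 = 2 ^ n\<close>.  As \<open>S\<close> is a
  Gaussian integer and \<open>n\<close> is odd, \<open>S\<close> is \<open>(1 + \<i>) ^ n\<close> up to a unit, whence \<open>S ^ 4 = - (4 ^ n)\<close>.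
  Summing fourth powers over all characters then leaves exactly \<open>2 ^ n\<close> solutions of the
  second equation, which are the trivial ones \<open>x = y = z = w\<close>.
\<close>

lemma CHAR_4_imp_four_eq_0:
  assumes "CHAR('a::comm_ring_1) = 4"
  shows "(4::'a) = 0"
  using of_nat_CHAR[where 'a = 'a] assms by simp

lemma CHAR_4_imp_two_neq_0:
  assumes "CHAR('a::comm_ring_1) = 4"
  shows "(2::'a) \<noteq> 0"
proof
  assume "(2::'a) = 0"
  then have "of_nat 2 = (0::'a)" by simp
  then have "4 dvd (2::nat)" unfolding of_nat_eq_0_iff_char_dvd assms .
  then show False by simp
qed

section \<open>The Teichmueller set\<close>

locale teichmueller =
  fixes n :: nat and G T :: "'r::{comm_ring_1,finite} set"
  assumes n_pos: "n > 0"
    and galois: "galois_ring TYPE('r)" and char: "CHAR('r) = 4" and card_R: "CARD('r) = 4 ^ n"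
    and group_G: "teich_group n G" and T_eq: "T = insert 0 G"
begin

lemmas four_eq_0 = CHAR_4_imp_four_eq_0[OF char]
  and two_neq_0 = CHAR_4_imp_two_neq_0[OF char]

lemma four_mult [simp]: "4 * (x::'r) = 0"
  by (simp add: four_eq_0)

lemma two_two_mult [simp]: "2 * (2 * (x::'r)) = 0"
  by (simp flip: mult.assoc)

text \<open>The prime in \<open>galois_ring\<close> must be 2: an odd p satisfies p * p = 1 in
  characteristic 4, which would make 1 a zero divisor. Since 2 is nonzero, anything it annihilates
  is then a zero divisor and so a multiple of 2.\<close>

lemma two_mult_eq_0_iff: "2 * (x::'r) = 0 \<longleftrightarrow> x \<in> range ((*) 2)"
proof -
  obtain p :: nat where "prime p"
    and zd: "{x::'r. \<exists>y. y \<noteq> 0 \<and> x * y = 0} = range (\<lambda>y. of_nat p * y)"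
    using galois unfolding galois_ring_def by auto
  have "even p"
  proof (rule ccontr)
    assume "odd p"
    then obtain k where "p = 2 * k + 1" by (metis oddE)
    then have "of_nat p * of_nat p = (1::'r) + 4 * (of_nat k * of_nat k + of_nat k)"
      by (simp add: algebra_simps)
    then have "(1::'r) = of_nat p * of_nat p" by simp
    then have "(1::'r) \<in> range (\<lambda>y. of_nat p * y)" by blast
    then show False unfolding zd[symmetric] by auto
  qed
  then have "p = 2" using \<open>prime p\<close> by (metis prime_nat_iff primes_dvd_imp_eq two_is_prime_nat)
  then have zd2: "{x::'r. \<exists>y. y \<noteq> 0 \<and> x * y = 0} = range ((*) 2)"
    using zd by simp
  show ?thesis
  proof
    assume "2 * x = 0"
    then have "x * 2 = 0" by (simp add: mult.commute)
    then show "x \<in> range ((*) 2)" unfolding zd2[symmetric] using two_neq_0 by blast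
  qed auto
qed

lemma two_mult_eq_iff: "2 * (x::'r) = 2 * y \<longleftrightarrow> (\<exists>t. x = y + 2 * t)"
  using two_mult_eq_0_iff[of "x - y"] by (auto simp: algebra_simps image_iff)

lemma zero_notin_G: "0 \<notin> G"
proof
  assume "0 \<in> G"
  then have "(1::'r) = 0" using group_G by (auto simp: teich_group_def)
  then show False by simp
qed

lemma card_T: "card T = 2 ^ n"
  using group_G zero_notin_G by (simp add: T_eq teich_group_def)

lemma zero_in_T [simp]: "0 \<in> T" and one_in_T [simp]: "1 \<in> T"
  using group_G by (auto simp: T_eq teich_group_def)

lemma T_mult [simp]: "x \<in> T \<Longrightarrow> y \<in> T \<Longrightarrow> x * y \<in> T"
  using group_G by (auto simp: T_eq teich_group_def)

lemma T_power [simp]: "x \<in> T \<Longrightarrow> x ^ k \<in> T"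
  by (induction k) auto

lemma T_inverse: "x \<in> T \<Longrightarrow> x \<noteq> 0 \<Longrightarrow> \<exists>y\<in>T. x * y = 1"
  using group_G by (auto simp: T_eq teich_group_def)

text \<open>Fermat's argument: multiplication by a nonzero x permutes \<open>G\<close>, so the
  product over \<open>G\<close> absorbs the factor x ^ card G, and this product is a unit.\<close>

lemma power_card_T:
  assumes "x \<in> T"
  shows "x ^ (2 ^ n) = x"
proof (cases "x = 0")
  case False
  then have x: "x \<in> G" using assms by (simp add: T_eq)
  obtain y where y: "y \<in> G" "x * y = 1" using group_G x by (auto simp: teich_group_def)
  have m: "\<And>u v. u \<in> G \<Longrightarrow> v \<in> G \<Longrightarrow> u * v \<in> G" using group_G by (auto simp: teich_group_def)
  have inj: "inj_on ((*) x) G"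
    by (rule inj_onI) (metis y(2) mult.assoc mult.commute mult_1)
  have im: "(*) x ` G = G"
    using m x by (intro card_subset_eq) (auto simp: card_image inj)
  have "\<Prod>G = (\<Prod>g\<in>G. x * g)"
    using prod.reindex[OF inj, of id] im by simp
  also have "\<dots> = x ^ card G * \<Prod>G" by (simp add: prod.distrib)
  finally have e: "\<Prod>G = x ^ card G * \<Prod>G" .
  have "\<Prod>G dvd 1"
  proof -
    have "\<Prod>G dvd (\<Prod>g\<in>G. 1)"
      using group_G by (intro prod_dvd_prod) (auto simp: teich_group_def)
    then show ?thesis by simp
  qed
  then obtain z where "\<Prod>G * z = 1" by (metis dvdE)
  then have "x ^ card G = 1" using e by (metis mult.assoc mult.right_neutral)
  then have "x ^ (2 ^ n - 1) = 1" using group_G by (simp add: teich_group_def)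
  then have "x ^ Suc (2 ^ n - 1) = x" unfolding power_Suc by simp
  moreover have "Suc (2 ^ n - 1) = 2 ^ n" by simp
  ultimately show ?thesis by simp
qed (simp add: power_0_left)

text \<open>Raising a square to the power 2 ^ (n - 1) recovers the original element by
  \<open>power_card_T\<close>.\<close>

lemma T_eqI:
  assumes "x \<in> T" "y \<in> T" "x\<^sup>2 = y\<^sup>2"
  shows "x = y"
proof -
  have "(2::nat) ^ n = 2 * 2 ^ (n - 1)" using n_pos by (cases n) auto
  then have "z ^ (2 ^ n) = (z\<^sup>2) ^ (2 ^ (n - 1))" for z :: 'r by (simp add: power_mult)
  then show ?thesis using power_card_T assms by metis
qed

lemma teich_sqrt:
  assumes "z \<in> T"
  shows "teich_sqrt T z \<in> T" "(teich_sqrt T z)\<^sup>2 = z"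
proof -
  have "(2::nat) ^ n = 2 ^ (n - 1) * 2" using n_pos by (cases n) auto
  \<comment> \<open>The root is itself a power of z, so it lies in \<open>T\<close>.\<close>
  then have "(z ^ (2 ^ (n - 1)))\<^sup>2 = z" using power_card_T[OF assms] by (simp flip: power_mult)
  then have "\<exists>!y. y \<in> T \<and> y\<^sup>2 = z" using assms T_eqI T_power by metis
  then have "teich_sqrt T z \<in> T \<and> (teich_sqrt T z)\<^sup>2 = z"
    unfolding teich_sqrt_def by (rule theI')
  then show "teich_sqrt T z \<in> T" "(teich_sqrt T z)\<^sup>2 = z" by auto
qed

section \<open>Reduction modulo 2 and two-digit expansions\<close>

lemma T_inj_mod2:
  assumes "x \<in> T" "y \<in> T" "2 * x = 2 * y"
  shows "x = y"
proof (rule T_eqI)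
  obtain t where "x = y + 2 * t" using assms(3) two_mult_eq_iff by auto
  \<comment> \<open>A congruence modulo 2 becomes an equality of squares in characteristic 4, and
    squaring is injective on \<open>T\<close>.\<close>
  then have "x\<^sup>2 = y\<^sup>2 + 4 * (y * t + t * t)" by (simp add: power2_eq_square algebra_simps)
  then show "x\<^sup>2 = y\<^sup>2" by simp
qed (use assms in auto)

text \<open>By counting: the expansions are distinct, because a is determined modulo 2 and then b
  is, and there are 4 ^ n of them.\<close>

lemma teich_decomposition:
  obtains a b where "a \<in> T" "b \<in> T" "r = a + 2 * b"
proof -
  have inj: "inj_on (\<lambda>(a, b). a + 2 * b) (T \<times> T)"
  proof (rule inj_onI, clarsimp)
    fix a b a' b'
    assume *: "a \<in> T" "b \<in> T" "a' \<in> T" "b' \<in> T" and e: "a + 2 * b = a' + 2 * b'"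
    have "2 * a = 2 * a'" using arg_cong[OF e, of "(*) 2"] by (simp add: distrib_left)
    then have "a = a'" using * T_inj_mod2 by auto
    then show "a = a' \<and> b = b'" using e * T_inj_mod2 by auto
  qed
  have "(\<lambda>(a, b). a + 2 * b) ` (T \<times> T) = UNIV"
    by (intro card_subset_eq)
      (auto simp: card_image[OF inj] card_T card_R card_cartesian_product simp flip: power_mult_distrib)
  then have "r \<in> (\<lambda>(a, b). a + 2 * b) ` (T \<times> T)" by simp
  then show ?thesis using that by auto
qed

lemma card_range_two: "card (range ((*) (2::'r))) = 2 ^ n"
proof -
  have "range ((*) (2::'r)) = (*) 2 ` T"
  proof
    show "range ((*) 2) \<subseteq> (*) 2 ` T"
    proof clarify
      fix r :: 'r
      obtain a b where "a \<in> T" "r = a + 2 * b" by (rule teich_decomposition[of r])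
      then show "2 * r \<in> (*) 2 ` T" by (simp add: distrib_left)
    qed
  qed auto
  moreover have "inj_on ((*) 2) T" by (auto intro: inj_onI T_inj_mod2)
  ultimately show ?thesis by (simp add: card_image card_T)
qed

text \<open>Every nonzero ideal contains 2, so a character that is nontrivial at 2 is nontrivial on
  every nonzero ideal. The leading nonzero digit of c is invertible and yields d.\<close>

lemma exists_mult_eq_two:
  assumes "(c::'r) \<noteq> 0"
  shows "\<exists>d. c * d = 2"
proof -
  obtain a b where ab: "a \<in> T" "b \<in> T" "c = a + 2 * b" by (rule teich_decomposition)
  show ?thesis
  proof (cases "a = 0")
    case False
    then obtain y where "a * y = 1" using T_inverse ab(1) by auto
    moreover have "c * (2 * y) = 2 * (a * y) + 4 * (b * y)"
      by (simp add: ab algebra_simps)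
    ultimately have "c * (2 * y) = 2" by simp
    then show ?thesis ..
  next
    case True
    then obtain y where "b * y = 1" using T_inverse[of b] ab assms by fastforce
    then have "c * y = 2" using True by (simp add: ab mult.assoc)
    then show ?thesis ..
  qed
qed

text \<open>This is injectivity of the Frobenius map of the residue field, of characteristic
  2.\<close>

lemma two_mult_square_eq_iff: "2 * (a::'r)\<^sup>2 = 2 * b\<^sup>2 \<longleftrightarrow> 2 * a = 2 * b"
proof
  assume e: "2 * a = 2 * b"
  have "2 * a\<^sup>2 = (2 * a) * a" by (simp add: power2_eq_square mult.assoc)
  also have "\<dots> = a * (2 * b)" unfolding e by (simp add: mult.commute)
  also have "\<dots> = (2 * a) * b" by (simp add: mult.assoc mult.left_commute)
  also have "\<dots> = 2 * b\<^sup>2" unfolding e by (simp add: power2_eq_square mult.assoc)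
  finally show "2 * a\<^sup>2 = 2 * b\<^sup>2" .
next
  obtain a0 a1 where a: "a0 \<in> T" "a = a0 + 2 * a1" by (rule teich_decomposition)
  obtain b0 b1 where b: "b0 \<in> T" "b = b0 + 2 * b1" by (rule teich_decomposition)
  have sq: "(x + 2 * y)\<^sup>2 = x\<^sup>2 + 4 * (x * y + y * y)" for x y :: 'r
    by (simp add: power2_eq_square algebra_simps)
  assume "2 * a\<^sup>2 = 2 * b\<^sup>2"
  then have "2 * a0\<^sup>2 = 2 * b0\<^sup>2" unfolding a(2) b(2) sq by simp
  then have "a0 = b0" using a(1) b(1) T_inj_mod2 T_eqI T_power by metis
  then show "2 * a = 2 * b" by (simp add: a b distrib_left)
qed

lemma two_mult_teich_add: "2 * teich_add T x y = 2 * (x + y)"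
  by (simp add: teich_add_def distrib_left)

text \<open>If \<open>x = u\<^sup>2\<close>, \<open>y = v\<^sup>2\<close> and \<open>u + v = c + 2d\<close> then \<open>x \<oplus> y = (u + v)\<^sup>2 = c\<^sup>2\<close>.\<close>

lemma teich_add_in_T [simp]:
  assumes "x \<in> T" "y \<in> T"
  shows "teich_add T x y \<in> T"
proof -
  define u v where "u = teich_sqrt T x" and "v = teich_sqrt T y"
  have u: "u \<in> T" "u\<^sup>2 = x" and v: "v \<in> T" "v\<^sup>2 = y"
    using teich_sqrt assms by (auto simp: u_def v_def)
  have "teich_sqrt T (x * y) = u * v"
    by (rule T_eqI) (use teich_sqrt[of "x * y"] assms u v in \<open>simp_all add: power_mult_distrib\<close>)
  then have e: "teich_add T x y = (u + v)\<^sup>2"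
    unfolding teich_add_def using u v by (simp add: power2_eq_square algebra_simps)
  obtain c d where c: "c \<in> T" "u + v = c + 2 * d" by (rule teich_decomposition)
  have "(u + v)\<^sup>2 = c\<^sup>2 + 4 * (c * d + d * d)"
    unfolding c by (simp add: power2_eq_square algebra_simps)
  then show ?thesis using e c(1) by simp
qed

lemma teich_add_unique: "x \<in> T \<Longrightarrow> y \<in> T \<Longrightarrow> z \<in> T \<Longrightarrow> 2 * z = 2 * (x + y) \<Longrightarrow> z = teich_add T x y"
  by (rule T_inj_mod2) (auto simp: two_mult_teich_add)

section \<open>Column differences and planarity\<close>

definition column :: "('r \<Rightarrow> 'r) \<Rightarrow> 'r \<Rightarrow> 'r" where
  "column f x = x + 2 * teich_sqrt T (f x)"

lemma two_mult_column: "2 * column f x = 2 * x"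
  by (simp add: column_def distrib_left)

text \<open>Expanding x \<oplus> e turns the column difference into e + 2 A(x), where A(x) is a sum
  of three square roots. Only A modulo 2 matters, and squaring modulo 2 removes the roots without
  losing information.\<close>

lemma column_diff_eq_iff:
  assumes f: "f \<in> T \<rightarrow> T" and T: "x \<in> T" "y \<in> T" "e \<in> T"
  shows "column f (teich_add T x e) - column f x = column f (teich_add T y e) - column f y \<longleftrightarrow>
    2 * (f (teich_add T x e) + f x + e * x) = 2 * (f (teich_add T y e) + f y + e * y)"
proof -
  define A where "A = (\<lambda>x. teich_sqrt T (x * e) + teich_sqrt T (f (teich_add T x e)) + teich_sqrt T (f x))"
  have d: "column f (teich_add T x e) - column f x = e + 2 * A x" for x
  proof -
    \<comment> \<open>Signs disappear on multiples of 2, so the subtracted root enters A with a plus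
      sign.\<close>
    have "- (2 * z) = 2 * z" for z :: 'r
    proof -
      have "2 * z + 2 * z = 4 * z" by simp
      then show ?thesis unfolding neg_eq_iff_add_eq_0 by simp
    qed
    then show ?thesis
      by (simp add: column_def A_def teich_add_def algebra_simps)
  qed
  have s: "2 * (A x)\<^sup>2 = 2 * (f (teich_add T x e) + f x + e * x)" if "x \<in> T" for x
  proof -
    have sq: "2 * (a + b + c)\<^sup>2 = 2 * (b\<^sup>2 + c\<^sup>2 + a\<^sup>2)" for a b c :: 'r
    proof -
      have "2 * (a + b + c)\<^sup>2 = 2 * (b\<^sup>2 + c\<^sup>2 + a\<^sup>2) + 4 * (a * b + b * c + a * c)"
        by (simp add: power2_eq_square algebra_simps)
      then show ?thesis by simp
    qed
    have "f (teich_add T x e) \<in> T" "f x \<in> T" "x * e \<in> T"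
      using f that T by auto
    then show ?thesis unfolding A_def sq using teich_sqrt(2) by (simp add: mult.commute)
  qed
  show ?thesis unfolding d s[OF T(1), symmetric] s[OF T(2), symmetric]
    by (simp add: two_mult_square_eq_iff)
qed

text \<open>Modulo 2 the equation of column differences says that both pairs differ by the same e in
  \<open>T\<close>. It then says that the planarity map of e agrees at y and w. On the finite set
  \<open>T\<close>, being a permutation amounts to injectivity.\<close>

lemma planar_iff_column_diff:
  assumes f: "f \<in> T \<rightarrow> T"
  shows "planar T f \<longleftrightarrow> (\<forall>x\<in>T. \<forall>y\<in>T. \<forall>z\<in>T. \<forall>w\<in>T.
    x \<noteq> y \<longrightarrow> column f x - column f y = column f z - column f w \<longrightarrow> x = z \<and> y = w)"
    (is "_ \<longleftrightarrow> ?R")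
proof -
  define D where "D = (\<lambda>e x. teich_add T (teich_add T (f (teich_add T x e)) (f x)) (e * x))"
  have DT: "D e x \<in> T" if "e \<in> T" "x \<in> T" for e x
    using f that by (auto simp: D_def Pi_iff)
  have D2: "2 * D e x = 2 * (f (teich_add T x e) + f x + e * x)" for e x
    by (simp add: D_def two_mult_teich_add distrib_left)
  have Deq: "D e x = D e y \<longleftrightarrow>
      column f (teich_add T x e) - column f x = column f (teich_add T y e) - column f y"
    if "e \<in> T" "x \<in> T" "y \<in> T" for e x y
    using column_diff_eq_iff[OF f that(2,3,1)] D2 DT that T_inj_mod2 by metis
  have "planar T f \<longleftrightarrow> (\<forall>e\<in>T - {0}. inj_on (D e) T)"
  proof -
    have "bij_betw (D e) T T \<longleftrightarrow> inj_on (D e) T" if "e \<in> T - {0}" for e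
      using that DT[of e] endo_inj_surj[of T "D e"] by (auto simp: bij_betw_def image_subset_iff)
    then show ?thesis by (simp add: planar_def D_def)
  qed
  also have "\<dots> \<longleftrightarrow> ?R"
  proof
    assume inj: "\<forall>e\<in>T - {0}. inj_on (D e) T"
    show ?R
    proof (intro ballI impI)
      fix x y z w
      assume T: "x \<in> T" "y \<in> T" "z \<in> T" "w \<in> T" and "x \<noteq> y"
        and eq: "column f x - column f y = column f z - column f w"
      \<comment> \<open>The required e is the representative in \<open>T\<close> of x - y modulo
        2.\<close>
      obtain e b where e: "e \<in> T" "x - y = e + 2 * b" by (rule teich_decomposition)
      have e2: "2 * e = 2 * (x - y)" unfolding e by (simp add: distrib_left)
      have "2 * (column f x - column f y) = 2 * (column f z - column f w)" using eq by simp
      then have "2 * (x - y) = 2 * (z - w)"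
        by (simp add: right_diff_distrib two_mult_column)
      then have x: "x = teich_add T y e" and z: "z = teich_add T w e"
        using T e e2 by (auto intro!: teich_add_unique simp: algebra_simps)
      have "e \<noteq> 0"
      proof
        assume "e = 0"
        then have "2 * x = 2 * y" using e2 by (simp add: algebra_simps)
        then show False using T T_inj_mod2 \<open>x \<noteq> y\<close> by blast
      qed
      then have "inj_on (D e) T" using inj e by auto
      moreover have "D e y = D e w" using Deq e T eq x z by metis
      ultimately have "y = w" using T by (auto dest: inj_onD)
      then show "x = z \<and> y = w" using x z by simp
    qed
  next
    assume R: ?R
    show "\<forall>e\<in>T - {0}. inj_on (D e) T"
    proof (intro ballI inj_onI)
      fix e x y
      assume e: "e \<in> T - {0}" and T: "x \<in> T" "y \<in> T" and "D e x = D e y"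
      have "teich_add T x e \<noteq> x"
      proof
        assume "teich_add T x e = x"
        then have "2 * x = 2 * (x + e)" using two_mult_teich_add by metis
        then have "2 * e = 2 * 0" by (simp add: algebra_simps)
        then show False using e T_inj_mod2[of e 0] by auto
      qed
      then show "x = y"
        using R e T \<open>D e x = D e y\<close> Deq[of e x y] teich_add_in_T by (metis DiffD1)
    qed
  qed
  finally show ?thesis .
qed

end

section \<open>Character sums\<close>

text \<open>A character on a subgroup containing a extends as long as the subgroup is proper, so one
  with a largest domain is defined everywhere. The start is the subgroup {0, a} with value -1 at
  a.\<close>

lemma exists_character:
  fixes a :: "'a::{ab_group_add,finite}"
  assumes exp4: "\<And>x::'a. x + x + (x + x) = 0" and a: "a + a = 0" "a \<noteq> 0"
  shows "\<exists>\<chi>::'a \<Rightarrow> complex. (\<forall>x y. \<chi> (x + y) = \<chi> x * \<chi> y) \<and> \<chi> a = -1"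
proof -
  define P where "P = (\<lambda>(H::'a set, \<chi>::'a \<Rightarrow> complex). a \<in> H \<and> (\<forall>x\<in>H. -x \<in> H) \<and>
    (\<forall>x\<in>H. \<forall>y\<in>H. x + y \<in> H \<and> \<chi> (x + y) = \<chi> x * \<chi> y) \<and> \<chi> a = -1)"
  have ma: "- a = a" using a(1) by (simp add: neg_eq_iff_add_eq_0)
  have "P ({0, a}, \<lambda>x. if x = a then -1 else 1)"
    using a ma by (auto simp: P_def)
  then have "\<exists>z. P z \<and> (\<forall>z'. P z' \<longrightarrow> card (fst z') \<le> card (fst z))"
    by (rule ex_has_greatest_nat[where b = "Suc (CARD('a))"]) (auto simp: less_Suc_eq_le intro: card_mono)
  then obtain H \<chi> where PH: "P (H, \<chi>)" and max: "\<And>z'. P z' \<Longrightarrow> card (fst z') \<le> card H"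
    by (metis fst_conv surj_pair)
  have aH: "a \<in> H" and neg: "\<And>x. x \<in> H \<Longrightarrow> -x \<in> H"
    and add: "\<And>x y. x \<in> H \<Longrightarrow> y \<in> H \<Longrightarrow> x + y \<in> H"
    and hom: "\<And>x y. x \<in> H \<Longrightarrow> y \<in> H \<Longrightarrow> \<chi> (x + y) = \<chi> x * \<chi> y"
    and chia: "\<chi> a = -1"
    using PH by (auto simp: P_def)
  have diff: "x - y \<in> H" if "x \<in> H" "y \<in> H" for x y
    using add[OF that(1) neg[OF that(2)]] by simp
  have zero: "0 \<in> H" using diff[OF aH aH] by simp
  have "H = UNIV"
  proof (rule ccontr)
    assume "H \<noteq> UNIV"
    then obtain u where u: "u \<notin> H" by auto
    \<comment> \<open>Either u itself works or u + u does, because doubling u twice gives 0.\<close>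
    obtain v where v: "v \<notin> H" "v + v \<in> H"
      using u zero exp4[of u] by (cases "u + u \<in> H") auto
    \<comment> \<open>The new value at v only has to square to the old value at v + v. As v + v lies
      in \<open>H\<close>, adjoining v adds just the one coset v + \<open>H\<close>.\<close>
    define c where "c = csqrt (\<chi> (v + v))"
    have cc: "c * c = \<chi> (v + v)" by (simp add: c_def flip: power2_eq_square)
    define H' where "H' = {x. x \<in> H \<or> x - v \<in> H}"
    define \<chi>' where "\<chi>' = (\<lambda>x. if x \<in> H then \<chi> x else c * \<chi> (x - v))"
    have not: "x \<notin> H" if "x - v \<in> H" for x
      using diff[of x "x - v"] that v(1) by auto
    have c1: "x + y \<in> H' \<and> \<chi>' (x + y) = \<chi>' x * \<chi>' y" if "x \<in> H" "y \<in> H" for x y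
      using that add hom by (auto simp: H'_def \<chi>'_def)
    have c2: "x + y \<in> H' \<and> \<chi>' (x + y) = \<chi>' x * \<chi>' y" if "x \<in> H" "y - v \<in> H" for x y
    proof -
      have e: "x + y - v = x + (y - v)" by simp
      have m: "x + y - v \<in> H" unfolding e using add that by blast
      then show ?thesis
        using that not[of "x + y"] not[of y] hom[OF that] by (auto simp: H'_def \<chi>'_def e)
    qed
    have c3: "x + y \<in> H' \<and> \<chi>' (x + y) = \<chi>' x * \<chi>' y" if "x - v \<in> H" "y - v \<in> H" for x y
    proof -
      have e: "x + y = (v + v) + ((x - v) + (y - v))" by simp
      have m: "x + y \<in> H" unfolding e using add that v(2) by blast
      have "\<chi> (x + y) = \<chi> (v + v) * (\<chi> (x - v) * \<chi> (y - v))"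
        unfolding e using that v(2) by (simp only: hom add)
      then show ?thesis
        using m not[of x] not[of y] that by (auto simp: H'_def \<chi>'_def cc[symmetric])
    qed
    have "\<forall>x\<in>H'. \<forall>y\<in>H'. x + y \<in> H' \<and> \<chi>' (x + y) = \<chi>' x * \<chi>' y"
    proof (intro ballI)
      fix x y
      assume "x \<in> H'" "y \<in> H'"
      then consider "x \<in> H" "y \<in> H" | "x \<in> H" "y - v \<in> H" | "y \<in> H" "x - v \<in> H"
        | "x - v \<in> H" "y - v \<in> H" by (auto simp: H'_def)
      then show "x + y \<in> H' \<and> \<chi>' (x + y) = \<chi>' x * \<chi>' y"
        by cases (use c1 c2 c3 c2[of y x] in \<open>simp_all add: add.commute mult.commute\<close>)
    qed
    moreover have "- x \<in> H'" if "x \<in> H'" for x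
    proof -
      have "- x - v \<in> H" if "x - v \<in> H"
        using neg[OF add[OF that v(2)]] by (simp add: algebra_simps minus_diff_commute)
      then show ?thesis using that neg by (auto simp: H'_def)
    qed
    ultimately have "P (H', \<chi>')"
      using aH chia by (auto simp: P_def H'_def \<chi>'_def)
    from max[OF this] have "card H' \<le> card H" by simp
    moreover have "H \<subseteq> H'" "v \<in> H'" using zero by (auto simp: H'_def)
    then have "H \<subset> H'" using v(1) by blast
    then have "card H < card H'" by (intro psubset_card_mono) auto
    ultimately show False by simp
  qed
  then show ?thesis using hom chia by auto
qed

section \<open>Gaussian integers of norm an odd power of 2\<close>

text \<open>Descent: two odd squares sum to 2 modulo 4, so for positive k both numbers are even and
  can be halved. The descent ends at 2 = 1 + 1.\<close>

lemma sum_two_squares_eq_two_times_four_power: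
  fixes p q :: int
  assumes "p\<^sup>2 + q\<^sup>2 = 2 * 4 ^ k"
  shows "p\<^sup>2 = q\<^sup>2"
  using assms
proof (induction k arbitrary: p q)
  case 0
  then have "p\<^sup>2 + q\<^sup>2 = 2" by simp
  moreover have "p\<^sup>2 \<noteq> 0 \<or> q\<^sup>2 \<noteq> 2" "p\<^sup>2 \<noteq> 2 \<or> q\<^sup>2 \<noteq> 0"
  proof -
    have "x\<^sup>2 \<noteq> 2" for x :: int
    proof
      assume x: "x\<^sup>2 = 2"
      then have "even x" by (metis even_power even_numeral)
      then obtain y where "x = 2 * y" by auto
      then have "4 * y\<^sup>2 = 2" using x by (simp add: power_mult_distrib)
      moreover have "4 * z \<noteq> 2" for z :: int by presburger
      ultimately show False by blast
    qed
    then show "p\<^sup>2 \<noteq> 0 \<or> q\<^sup>2 \<noteq> 2" "p\<^sup>2 \<noteq> 2 \<or> q\<^sup>2 \<noteq> 0" by auto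
  qed
  moreover have "p\<^sup>2 \<ge> 0" "q\<^sup>2 \<ge> 0" by auto
  ultimately show ?case by linarith
next
  case (Suc k)
  have par: "even p \<longleftrightarrow> even q"
    using Suc.prems by (metis dvd_triv_left even_add even_power pos2)
  have "even p"
  proof (rule ccontr)
    assume "odd p"
    then obtain a b where "p = 2 * a + 1" "q = 2 * b + 1" using par by (metis oddE)
    then have "4 * (a\<^sup>2 + a + b\<^sup>2 + b) + 2 = 4 * (2 * 4 ^ k)"
      using Suc.prems by (simp add: power2_eq_square algebra_simps)
    moreover have "4 * x + 2 \<noteq> 4 * y" for x y :: int by presburger
    ultimately show False by blast
  qed
  then obtain a b where "p = 2 * a" "q = 2 * b" using par by (metis evenE)
  moreover from this have "a\<^sup>2 + b\<^sup>2 = 2 * 4 ^ k" using Suc.prems by (simp add: power_mult_distrib)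
  then have "a\<^sup>2 = b\<^sup>2" by (rule Suc.IH)
  ultimately show ?case by (simp add: power_mult_distrib)
qed

lemma sum_fourth_roots_of_unity:
  assumes "\<And>i. i \<in> A \<Longrightarrow> z i \<in> {1, -1, \<i>, -\<i>}"
  shows "\<exists>p q :: int. (\<Sum>i\<in>A. z i) = Complex (of_int p) (of_int q)"
proof -
  have "\<exists>p :: int. Re (\<Sum>i\<in>A. z i) = of_int p"
  proof -
    \<comment> \<open>Each real part is -1, 0 or 1, so taking the floor exhibits it as an integer
      without changing it.\<close>
    have "Re (\<Sum>i\<in>A. z i) = (\<Sum>i\<in>A. of_int \<lfloor>Re (z i)\<rfloor>)"
      using assms unfolding Re_sum by (intro sum.cong) force+
    then show ?thesis by (metis of_int_sum)
  qed
  moreover have "\<exists>q :: int. Im (\<Sum>i\<in>A. z i) = of_int q"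
  proof -
    have "Im (\<Sum>i\<in>A. z i) = (\<Sum>i\<in>A. of_int \<lfloor>Im (z i)\<rfloor>)"
      using assms unfolding Im_sum by (intro sum.cong) force+
    then show ?thesis by (metis of_int_sum)
  qed
  ultimately show ?thesis by (metis complex_surj)
qed

text \<open>Equality of p\<twosuperior> and q\<twosuperior> makes the square of the number purely
  imaginary, namely 2pq\<i>. Squaring again gives minus the square of the norm, whatever the signs
  of p and q.\<close>

lemma gaussian_fourth_power:
  fixes p q :: int
  assumes "Complex (of_int p) (of_int q) * cnj (Complex (of_int p) (of_int q)) = 2 ^ n" "odd n"
  shows "Complex (of_int p) (of_int q) ^ 4 = - (4 ^ n)"
proof -
  obtain k where n: "n = 2 * k + 1" using assms(2) by (metis oddE)
  have "complex_of_int (p\<^sup>2 + q\<^sup>2) = of_int (2 ^ n)"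
    using assms(1) by (simp add: complex_eq_iff power2_eq_square)
  then have pq: "p\<^sup>2 + q\<^sup>2 = 2 ^ n" unfolding of_int_eq_iff .
  then have eq: "p\<^sup>2 = q\<^sup>2"
    by (intro sum_two_squares_eq_two_times_four_power[of p q k]) (simp add: n power_mult)
  have "(4::int) ^ n = (2 ^ n)\<^sup>2" by (simp add: power2_eq_square flip: power_mult_distrib)
  then have "(4::int) ^ n = 4 * p\<^sup>2 * q\<^sup>2"
    unfolding pq[symmetric] using eq by (simp add: power2_eq_square algebra_simps)
  then have f: "(4::complex) ^ n = 4 * of_int p ^ 2 * of_int q ^ 2"
    by (metis (mono_tags, lifting) of_int_mult of_int_numeral of_int_power)
  have "(Complex (of_int p) (of_int q))\<^sup>2 = 2 * of_int p * of_int q * \<i>"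
    using arg_cong[OF eq, of real_of_int] by (simp add: complex_eq_iff power2_eq_square)
  then have "((Complex (of_int p) (of_int q))\<^sup>2)\<^sup>2 = - (4 * of_int p ^ 2 * of_int q ^ 2)"
    by (simp add: power_mult_distrib)
  then show ?thesis by (simp add: f flip: power_mult)
qed

section \<open>Orthogonality for a character nontrivial at 2\<close>

text \<open>With value -1 at 2, \<open>exists_mult_eq_two\<close> makes x \<mapsto> \<chi>(cx)
  nontrivial for every nonzero c. Hence c parametrizes all additive characters of the ring.\<close>

locale teichmueller_character = teichmueller +
  fixes \<chi> :: "'a \<Rightarrow> complex"
  assumes chi_add: "\<chi> (x + y) = \<chi> x * \<chi> y" and chi_two: "\<chi> 2 = -1"
begin

lemma chi_0 [simp]: "\<chi> 0 = 1"
  using chi_add[of 0 2] chi_two by simp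

lemma chi_values: "\<chi> x \<in> {1, -1, \<i>, -\<i>}"
proof -
  have "x + x + (x + x) = 4 * x" by simp
  then have "(\<chi> x * \<chi> x) * (\<chi> x * \<chi> x) = 1"
    by (metis chi_add chi_0 four_mult)
  then have "(\<chi> x - 1) * (\<chi> x + 1) * ((\<chi> x - \<i>) * (\<chi> x + \<i>)) = 0"
    by (simp add: algebra_simps)
  then show ?thesis by (auto simp: eq_neg_iff_add_eq_0)
qed

lemma chi_uminus: "\<chi> (- x) = cnj (\<chi> x)"
proof -
  have "\<chi> x * \<chi> (- x) = 1" using chi_add[of x "- x"] by simp
  moreover have "\<chi> x * cnj (\<chi> x) = 1" "\<chi> x \<noteq> 0" using chi_values[of x] by auto
  ultimately show ?thesis by (metis mult_left_cancel)
qed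

text \<open>Translation by b permutes the summands but multiplies the sum by a factor different from
  1.\<close>

lemma sum_chi_mult_eq_0:
  assumes "(\<lambda>x. x + b) ` A = A" "\<chi> (c * b) \<noteq> 1"
  shows "(\<Sum>r\<in>A. \<chi> (c * r)) = 0"
proof -
  have "(\<Sum>r\<in>A. \<chi> (c * r)) = (\<Sum>r\<in>(\<lambda>x. x + b) ` A. \<chi> (c * r))" using assms by simp
  also have "\<dots> = (\<Sum>r\<in>A. \<chi> (c * (r + b)))" by (subst sum.reindex) (auto intro: inj_onI)
  also have "\<dots> = (\<Sum>r\<in>A. \<chi> (c * r)) * \<chi> (c * b)"
    by (simp add: distrib_left chi_add sum_distrib_right)
  finally show ?thesis using assms(2) by simp
qed

lemma sum_chi_mult_UNIV:
  assumes "c \<noteq> 0"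
  shows "(\<Sum>r\<in>UNIV. \<chi> (c * r)) = 0"
proof -
  obtain d where "c * d = 2" using exists_mult_eq_two assms by auto
  moreover have "(\<lambda>x. x + d) ` UNIV = UNIV" by (metis surj_def diff_add_cancel)
  ultimately show ?thesis by (intro sum_chi_mult_eq_0[of d]) (simp_all add: chi_two)
qed

lemma sum_chi_mult_range_two:
  assumes "2 * c \<noteq> 0"
  shows "(\<Sum>r\<in>range ((*) 2). \<chi> (c * r)) = 0"
proof -
  \<comment> \<open>Translation by 2d preserves the multiples of 2, and the character takes the
    value -1 at c(2d) = 2.\<close>
  obtain d where d: "2 * c * d = 2" using exists_mult_eq_two assms by auto
  have "(\<lambda>x. x + 2 * d) ` range ((*) 2) = range ((*) 2)"
  proof
    show "range ((*) 2) \<subseteq> (\<lambda>x. x + 2 * d) ` range ((*) 2)"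
    proof clarify
      fix x
      have "2 * x = 2 * (x - d) + 2 * d" by (simp add: algebra_simps)
      then show "2 * x \<in> (\<lambda>x. x + 2 * d) ` range ((*) 2)" by blast
    qed
    show "(\<lambda>x. x + 2 * d) ` range ((*) 2) \<subseteq> range ((*) 2)"
    proof clarify
      fix x
      have "2 * x + 2 * d = 2 * (x + d)" by (simp add: distrib_left)
      then show "2 * x + 2 * d \<in> range ((*) 2)" by blast
    qed
  qed
  moreover have "\<chi> (c * (2 * d)) \<noteq> 1" using d chi_two by (simp add: ac_simps)
  ultimately show ?thesis by (rule sum_chi_mult_eq_0)
qed

lemma sum_chi_product:
  "(\<Sum>i\<in>A. \<chi> (c * u i)) * (\<Sum>j\<in>B. \<chi> (c * v j)) = (\<Sum>(i, j)\<in>A \<times> B. \<chi> (c * (u i + v j)))"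
  by (simp add: sum_product sum.cartesian_product distrib_left chi_add)

section \<open>Character sums over a system of representatives modulo 2\<close>

context
  fixes I :: "'i set" and h :: "'i \<Rightarrow> 'a"
  assumes card_I: "card I = 2 ^ n"
    and inj_mod2: "\<And>i j. i \<in> I \<Longrightarrow> j \<in> I \<Longrightarrow> 2 * h i = 2 * h j \<Longrightarrow> i = j"
begin

lemma finite_I: "finite I"
  using card_I by (intro card_ge_0_finite) simp

text \<open>Writing c = 2d moves the factor 2 to h. The values 2 h i run exactly once through the
  multiples of 2, which gives a complete sum of a nontrivial character.\<close>

lemma char_sum_even:
  assumes "2 * c = 0" "c \<noteq> 0"
  shows "(\<Sum>i\<in>I. \<chi> (c * h i)) = 0"
proof -
  obtain d where d: "c = 2 * d" using assms two_mult_eq_0_iff by auto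
  have inj: "inj_on (\<lambda>i. 2 * h i) I" using inj_mod2 by (auto intro: inj_onI)
  have im: "(\<lambda>i. 2 * h i) ` I = range ((*) 2)"
    by (intro card_subset_eq) (auto simp: card_image[OF inj] card_I card_range_two)
  have "(\<Sum>i\<in>I. \<chi> (c * h i)) = (\<Sum>i\<in>I. \<chi> (d * (2 * h i)))"
    by (simp add: d mult.left_commute mult.assoc)
  also have "\<dots> = (\<Sum>r\<in>range ((*) 2). \<chi> (d * r))"
    unfolding im[symmetric] by (simp add: sum.reindex[OF inj])
  also have "\<dots> = 0" using assms d by (intro sum_chi_mult_range_two) auto
  finally show ?thesis .
qed

context
  assumes differences: "\<And>i j k l. i \<in> I \<Longrightarrow> j \<in> I \<Longrightarrow> k \<in> I \<Longrightarrow> l \<in> I \<Longrightarrow>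
    i \<noteq> j \<Longrightarrow> h i - h j = h k - h l \<Longrightarrow> i = k \<and> j = l"
begin

text \<open>The differences \<open>h i - h j\<close> with \<open>i \<noteq> j\<close> run exactly once through the units.\<close>

lemma char_sum_norm:
  assumes "2 * c \<noteq> 0"
  shows "(\<Sum>i\<in>I. \<chi> (c * h i)) * cnj (\<Sum>i\<in>I. \<chi> (c * h i)) = 2 ^ n"
proof -
  define D where "D = I \<times> I - Id"
  have I2: "I \<times> I = Id_on I \<union> D" "Id_on I \<inter> D = {}" "finite D" "finite (Id_on I)"
    using finite_I by (auto simp: D_def Id_on_def)
  have cId: "card (Id_on I) = 2 ^ n"
  proof -
    have "Id_on I = (\<lambda>i. (i, i)) ` I" by (auto simp: Id_on_def)
    then show ?thesis by (simp add: card_image card_I inj_on_def)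
  qed
  have cD: "card D = 4 ^ n - 2 ^ n"
  proof -
    have "card (I \<times> I) = card (Id_on I) + card D" using I2 by (simp add: card_Un_disjoint)
    then show ?thesis using cId by (simp add: card_cartesian_product card_I flip: power_mult_distrib)
  qed
  have inj: "inj_on (\<lambda>(i, j). h i - h j) D"
    by (rule inj_onI) (use differences in \<open>auto simp: D_def\<close>)
  \<comment> \<open>Distinct indices are incongruent modulo 2, so no difference is a multiple of 2,
    and both sides have 4 ^ n - 2 ^ n elements. The diagonal then contributes 2 ^ n to the norm, and
    the rest contributes 0.\<close>
  have im: "(\<lambda>(i, j). h i - h j) ` D = UNIV - range ((*) 2)"
  proof (rule card_subset_eq)
    show "(\<lambda>(i, j). h i - h j) ` D \<subseteq> UNIV - range ((*) 2)"
    proof clarsimp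
      fix i j x
      assume ij: "(i, j) \<in> D" and "h i - h j = 2 * x"
      then have "2 * h i = 2 * h j" unfolding two_mult_eq_iff by (auto simp: algebra_simps)
      then show False using inj_mod2 ij by (auto simp: D_def)
    qed
  qed (auto simp: card_image[OF inj] cD card_Diff_subset card_R card_range_two)
  have c0: "c \<noteq> 0" using assms by auto
  have "(\<Sum>i\<in>I. \<chi> (c * h i)) * cnj (\<Sum>i\<in>I. \<chi> (c * h i)) =
      (\<Sum>i\<in>I. \<chi> (c * h i)) * (\<Sum>j\<in>I. \<chi> (c * (- h j)))"
    by (simp flip: chi_uminus)
  also have "\<dots> = (\<Sum>p\<in>I \<times> I. \<chi> (c * (case p of (i, j) \<Rightarrow> h i - h j)))"
    unfolding sum_chi_product by (intro sum.cong) auto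
  also have "\<dots> = (\<Sum>p\<in>Id_on I. \<chi> (c * (case p of (i, j) \<Rightarrow> h i - h j))) +
      (\<Sum>p\<in>D. \<chi> (c * (case p of (i, j) \<Rightarrow> h i - h j)))"
    unfolding I2(1) by (rule sum.union_disjoint) (use I2 in auto)
  also have "(\<Sum>p\<in>Id_on I. \<chi> (c * (case p of (i, j) \<Rightarrow> h i - h j))) = (\<Sum>p\<in>Id_on I. 1)"
    by (rule sum.cong) auto
  also have "\<dots> = 2 ^ n" by (simp add: cId)
  also have "(\<Sum>p\<in>D. \<chi> (c * (case p of (i, j) \<Rightarrow> h i - h j))) =
      (\<Sum>r\<in>UNIV - range ((*) 2). \<chi> (c * r))"
    unfolding im[symmetric] by (simp add: sum.reindex[OF inj])
  also have "\<dots> = 0"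
    by (simp add: sum_diff sum_chi_mult_UNIV[OF c0] sum_chi_mult_range_two[OF assms])
  finally show ?thesis by simp
qed

lemma char_sum_fourth_power:
  assumes "2 * c \<noteq> 0" "odd n"
  shows "(\<Sum>i\<in>I. \<chi> (c * h i)) ^ 4 = - (4 ^ n)"
proof -
  obtain p q :: int where "(\<Sum>i\<in>I. \<chi> (c * h i)) = Complex (of_int p) (of_int q)"
    using sum_fourth_roots_of_unity[of I "\<lambda>i. \<chi> (c * h i)"] chi_values by auto
  then show ?thesis
    using gaussian_fourth_power char_sum_norm[OF assms(1)] assms(2) by simp
qed

lemma sum_four_eq_0:
  assumes "odd n" "i \<in> I" "j \<in> I" "k \<in> I" "l \<in> I" "h i + h j + (h k + h l) = 0"
  shows "i = j \<and> j = k \<and> k = l"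
proof -
  let ?S = "\<lambda>c. \<Sum>i\<in>I. \<chi> (c * h i)"
  define u where "u = (\<lambda>((i, j), (k, l)). h i + h j + (h k + h l))"
  define Q where "Q = {p \<in> (I \<times> I) \<times> (I \<times> I). u p = 0}"
  have fQ: "finite Q" using finite_I by (simp add: Q_def)
  have S4: "?S c ^ 4 = (\<Sum>p\<in>(I \<times> I) \<times> (I \<times> I). \<chi> (u p * c))" for c
  proof -
    have "?S c ^ 4 = (?S c * ?S c) * (?S c * ?S c)" by (simp add: power4_eq_xxxx)
    also have "\<dots> = (\<Sum>p\<in>I \<times> I. \<chi> (c * (\<lambda>(i, j). h i + h j) p)) *
        (\<Sum>p\<in>I \<times> I. \<chi> (c * (\<lambda>(i, j). h i + h j) p))"
      unfolding sum_chi_product[where u = h and v = h] by (simp add: case_prod_unfold)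
    also have "\<dots> = (\<Sum>p\<in>(I \<times> I) \<times> (I \<times> I). \<chi> (u p * c))"
      unfolding sum_chi_product by (intro sum.cong) (auto simp: u_def mult.commute)
    finally show ?thesis .
  qed
  \<comment> \<open>By orthogonality, summing over c detects the quadruples with
    \<open>u p = 0\<close>, each with weight 4 ^ n.\<close>
  have "(\<Sum>c\<in>UNIV. ?S c ^ 4) = (\<Sum>p\<in>(I \<times> I) \<times> (I \<times> I). \<Sum>c\<in>UNIV. \<chi> (u p * c))"
    unfolding S4 by (rule sum.swap)
  also have "\<dots> = (\<Sum>p\<in>(I \<times> I) \<times> (I \<times> I). if u p = 0 then 4 ^ n else 0)"
    by (intro sum.cong) (auto simp: sum_chi_mult_UNIV card_R)
  also have "\<dots> = 4 ^ n * of_nat (card Q)"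
    using finite_I by (simp add: Q_def sum.If_cases Int_def mult.commute)
  finally have count: "(\<Sum>c\<in>UNIV. ?S c ^ 4) = 4 ^ n * of_nat (card Q)" .
  \<comment> \<open>The units contribute -(4 ^ n)(4 ^ n - 2 ^ n), the nonzero multiples of 2
    contribute 0 and c = 0 contributes 16 ^ n. The total is 4 ^ n times 2 ^ n.\<close>
  have "(\<Sum>c\<in>UNIV. ?S c ^ 4) = (\<Sum>c\<in>UNIV - range ((*) 2). ?S c ^ 4) + (\<Sum>c\<in>range ((*) 2). ?S c ^ 4)"
    by (rule sum.subset_diff) auto
  also have "(\<Sum>c\<in>UNIV - range ((*) 2). ?S c ^ 4) = (\<Sum>c\<in>UNIV - range ((*) (2::'a)). - (4 ^ n))"
    using two_mult_eq_0_iff assms(1) by (intro sum.cong char_sum_fourth_power) auto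
  also have "\<dots> = (4 ^ n - 2 ^ n) * (- (4 ^ n))"
    by (simp add: card_Diff_subset card_R card_range_two of_nat_diff power_mono)
  also have "(\<Sum>c\<in>range ((*) 2). ?S c ^ 4) = (\<Sum>c\<in>range ((*) (2::'a)). if c = 0 then (2 ^ n) ^ 4 else 0)"
    by (intro sum.cong) (auto simp: char_sum_even card_I)
  also have "\<dots> = (2 ^ n) ^ 4"
  proof -
    have "(0::'a) \<in> range ((*) 2)" by (metis mult_zero_right rangeI)
    then show ?thesis by (simp add: sum.delta)
  qed
  also have "(4 ^ n - 2 ^ n) * (- (4 ^ n)) + (2 ^ n) ^ 4 = (4 ^ n * 2 ^ n :: complex)"
  proof -
    have "(4::complex) ^ n = 2 ^ n * 2 ^ n" by (simp flip: power_mult_distrib)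
    then show ?thesis by (simp add: algebra_simps power4_eq_xxxx)
  qed
  finally have "of_nat (card Q) = (of_nat (2 ^ n) :: complex)" unfolding count by simp
  then have cQ: "card Q = 2 ^ n" unfolding of_nat_eq_iff .
  \<comment> \<open>The constant quadruples are solutions in characteristic 4, and there are already
    2 ^ n of them.\<close>
  have "(\<lambda>i. ((i, i), (i, i))) ` I = Q"
  proof (rule card_subset_eq[OF fQ])
    have "h i + h i + (h i + h i) = 4 * h i" for i by simp
    then show "(\<lambda>i. ((i, i), (i, i))) ` I \<subseteq> Q" by (auto simp: Q_def u_def)
    show "card ((\<lambda>i. ((i, i), (i, i))) ` I) = card Q"
      by (simp add: cQ card_image inj_on_def card_I)
  qed
  moreover have "((i, j), (k, l)) \<in> Q" using assms by (simp add: Q_def u_def)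
  ultimately show ?thesis by auto
qed

end

end

end

context teichmueller
begin

text \<open>The character served only the count; \<open>exists_character\<close> at a = 2 supplies
  one.\<close>

lemma sum_four_eq_0_if_differences:
  fixes h :: "'i \<Rightarrow> 'r"
  assumes "odd n" "card I = 2 ^ n"
    and "\<And>i j. i \<in> I \<Longrightarrow> j \<in> I \<Longrightarrow> 2 * h i = 2 * h j \<Longrightarrow> i = j"
    and "\<And>i j k l. i \<in> I \<Longrightarrow> j \<in> I \<Longrightarrow> k \<in> I \<Longrightarrow> l \<in> I \<Longrightarrow>
      i \<noteq> j \<Longrightarrow> h i - h j = h k - h l \<Longrightarrow> i = k \<and> j = l"
    and "i \<in> I" "j \<in> I" "k \<in> I" "l \<in> I" "h i + h j + (h k + h l) = 0"
  shows "i = j \<and> j = k \<and> k = l"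
proof -
  have "x + x + (x + x) = 4 * x" for x :: 'r by simp
  then obtain \<chi> :: "'r \<Rightarrow> complex" where "\<And>x y. \<chi> (x + y) = \<chi> x * \<chi> y" "\<chi> 2 = -1"
    using exists_character[of "2::'r"] two_neq_0 by (auto simp: four_eq_0)
  then interpret teichmueller_character n G T \<chi> by unfold_locales auto
  show ?thesis using sum_four_eq_0[of I h i j k l] assms by blast
qed

end

section \<open>Words of small Lee weight\<close>

lemma num4_cases:
  fixes c :: 4
  obtains "c = 0" | "c = 1" | "c = 2" | "c = 3"
proof (cases c)
  case (of_int z)
  then have "z = 0 \<or> z = 1 \<or> z = 2 \<or> z = 3" by auto
  then show ?thesis using of_int(1) that by auto
qed

lemma lee_weight_elem_simps [simp]:
  "lee_weight_elem 0 = 0" "lee_weight_elem 1 = 1" "lee_weight_elem 2 = 2" "lee_weight_elem 3 = 1" "lee_weight_elem 4 = 0"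
  by (simp_all add: lee_weight_elem_def)

lemma lee_weight_elem_uminus: "lee_weight_elem (- c) = lee_weight_elem c"
  by (cases c rule: num4_cases) (simp_all add: lee_weight_elem_def)

lemma lee_weight_elem_add_le: "lee_weight_elem (a + b) \<le> lee_weight_elem a + lee_weight_elem b"
  by (cases a rule: num4_cases; cases b rule: num4_cases) (simp_all add: lee_weight_elem_def)

lemma lee_weight_add_le:
  assumes "dim_vec u = dim_vec v"
  shows "lee_weight (u + v) \<le> lee_weight u + lee_weight v"
  using assms lee_weight_elem_add_le
  by (auto simp: lee_weight_def simp flip: sum.distrib intro!: sum_mono)

lemma lee_weight_uminus: "lee_weight (- v) = lee_weight v"
  by (simp add: lee_weight_def lee_weight_elem_uminus)

lemma lee_weight_unit_vec:
  assumes "i < N"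
  shows "lee_weight (unit_vec N i) = 1"
proof -
  have "lee_weight (unit_vec N i) = (\<Sum>j<N. if j = i then 1 else 0)"
    unfolding lee_weight_def using assms by (intro sum.cong) (auto simp: unit_vec_def)
  then show ?thesis using assms by simp
qed

lemma lee_weight_eq_0_iff: "lee_weight v = 0 \<longleftrightarrow> v = 0\<^sub>v (dim_vec v)"
  by (auto simp: lee_weight_def vec_eq_iff lee_weight_elem_def split: if_splits)

text \<open>A word of Lee weight k is a sum of k such vectors, where an entry 2 uses its coordinate
  twice.\<close>

definition signed_unit :: "nat \<Rightarrow> bool \<Rightarrow> nat \<Rightarrow> 4 vec" where
  "signed_unit N s i = (if s then unit_vec N i else - unit_vec N i)"

lemma signed_unit_carrier [simp]: "signed_unit N s i \<in> carrier_vec N"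
  by (simp add: signed_unit_def)

lemma lee_weight_remove_signed_unit:
  assumes c: "c \<in> carrier_vec N" and w: "lee_weight c = Suc k"
  shows "\<exists>d s i. d \<in> carrier_vec N \<and> i < N \<and> lee_weight d = k \<and> c = signed_unit N s i + d"
proof -
  have "\<exists>i<N. c $ i \<noteq> 0"
  proof (rule ccontr)
    assume "\<not> ?thesis"
    then have "lee_weight c = 0" using c by (auto simp: lee_weight_def)
    then show False using w by simp
  qed
  then obtain i where i: "i < N" "c $ i \<noteq> 0" by auto
  \<comment> \<open>The sign is chosen so that the entry moves towards 0: an entry 3 = -1 is raised,
    while 1 and 2 are lowered.\<close>
  define s where "s \<longleftrightarrow> c $ i \<noteq> 3"
  define d where "d = c - signed_unit N s i"
  have d: "d \<in> carrier_vec N" using c by (simp add: d_def)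
  have cd: "c = signed_unit N s i + d"
    using c by (intro eq_vecI) (auto simp: d_def signed_unit_def)
  have di: "d $ i = (if s then c $ i - 1 else c $ i + 1)"
    using c i by (simp add: d_def signed_unit_def)
  have "Suc (lee_weight_elem (d $ i)) = lee_weight_elem (c $ i)"
    unfolding di using i(2) by (cases "c $ i" rule: num4_cases) (auto simp: s_def)
  moreover have "(\<Sum>j\<in>{..<N} - {i}. lee_weight_elem (d $ j)) = (\<Sum>j\<in>{..<N} - {i}. lee_weight_elem (c $ j))"
    using c i(1) by (intro sum.cong) (auto simp: d_def signed_unit_def)
  ultimately have "Suc (lee_weight d) = lee_weight c"
    using c d i(1) by (simp add: lee_weight_def sum.remove[of "{..<N}" i])
  then show ?thesis using w d i(1) cd by auto
qed

section \<open>The code with check rows 1 and g\<close>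

locale z4_parity_check =
  fixes N :: nat and g :: "nat \<Rightarrow> 'r::comm_ring_1"
  assumes char_4: "CHAR('r) = 4"
    and inj_mod2: "\<And>i j. i < N \<Longrightarrow> j < N \<Longrightarrow> 2 * g i = 2 * g j \<Longrightarrow> i = j"
begin

lemmas four_zero = CHAR_4_imp_four_eq_0[OF char_4]
  and two_nonzero = CHAR_4_imp_two_neq_0[OF char_4]

text \<open>Passing to the representative only drops a multiple of 4. This makes the embedding
  additive although it is defined through representatives.\<close>

lemma z4_embed_of_int: "z4_embed (of_int z) = (of_int z :: 'r)"
proof -
  have "Rep_bit0 (of_int z :: 4) = z mod 4"
    using bit0.Rep_Abs_mod[where 'a = "num1 bit0", of z] by (simp add: bit0.of_int_eq)
  moreover have "(of_int z :: 'r) = of_int (4 * (z div 4) + z mod 4)" by simp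
  then have "(of_int z :: 'r) = of_int (z mod 4)"
    unfolding of_int_add of_int_mult by (simp add: four_zero)
  ultimately show ?thesis by (simp add: z4_embed_def)
qed

lemma z4_embed_simps:
  "z4_embed 0 = (0::'r)" "z4_embed 1 = (1::'r)"
  "z4_embed (a + b) = (z4_embed a + z4_embed b :: 'r)" "z4_embed (- a) = (- z4_embed a :: 'r)"
proof -
  show "z4_embed 0 = (0::'r)" "z4_embed 1 = (1::'r)"
    using z4_embed_of_int[of 0] z4_embed_of_int[of 1] by simp_all
  obtain x y where xy: "a = of_int x" "b = of_int y" by (metis bit0_cases)
  show "z4_embed (a + b) = (z4_embed a + z4_embed b :: 'r)"
    unfolding xy of_int_add[symmetric] z4_embed_of_int by simp
  show "z4_embed (- a) = (- z4_embed a :: 'r)"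
    unfolding xy of_int_minus[symmetric] z4_embed_of_int by simp
qed

text \<open>A residue and its Lee weight have the same parity; the case 3 uses 6 = 2. This links the
  all-one check row to the parity of the Lee weight.\<close>

lemma two_mult_lee_weight_elem: "2 * of_nat (lee_weight_elem a) = (2 * z4_embed a :: 'r)"
proof -
  have "2 * (3::'r) = 4 + 2" by simp
  then have six: "2 * (3::'r) = 2" by (simp only: four_zero add_0)
  have four: "2 * (2::'r) = 0" using four_zero by simp
  have z: "z4_embed 2 = (2 :: 'r)" "z4_embed 3 = (3 :: 'r)"
    using z4_embed_of_int[of 2] z4_embed_of_int[of 3] by simp_all
  show ?thesis
    by (cases a rule: num4_cases) (simp_all only: lee_weight_elem_simps z4_embed_simps z six four
        of_nat_0 of_nat_1 of_nat_numeral mult_1_right mult_zero_right)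
qed

text \<open>The row u is a parameter so that linearity is proved once for both check rows.\<close>

definition syndrome :: "(nat \<Rightarrow> 'r) \<Rightarrow> 4 vec \<Rightarrow> 'r" where
  "syndrome u c = (\<Sum>j<N. z4_embed (c $ j) * u j)"

lemma syndrome_add:
  "c \<in> carrier_vec N \<Longrightarrow> d \<in> carrier_vec N \<Longrightarrow> syndrome u (c + d) = syndrome u c + syndrome u d"
  by (simp add: syndrome_def z4_embed_simps distrib_right flip: sum.distrib)

lemma syndrome_uminus: "c \<in> carrier_vec N \<Longrightarrow> syndrome u (- c) = - syndrome u c"
  by (simp add: syndrome_def z4_embed_simps flip: sum_negf)

lemma syndrome_unit_vec:
  assumes "i < N"
  shows "syndrome u (unit_vec N i) = u i"
proof -
  have "syndrome u (unit_vec N i) = (\<Sum>j<N. if j = i then u j else 0)"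
    unfolding syndrome_def using assms by (intro sum.cong) (auto simp: z4_embed_simps)
  then show ?thesis using assms by simp
qed

lemma syndrome_signed_unit: "i < N \<Longrightarrow> syndrome u (signed_unit N s i) = (if s then u i else - u i)"
  by (simp add: signed_unit_def syndrome_uminus syndrome_unit_vec)

lemmas syndrome_simps = syndrome_add syndrome_uminus syndrome_unit_vec syndrome_signed_unit

definition code :: "4 vec set" where
  "code = {c \<in> carrier_vec N. syndrome (\<lambda>_. 1) c = 0 \<and> syndrome g c = 0}"

lemma code_uminus: "c \<in> code \<Longrightarrow> - c \<in> code"
  by (simp add: code_def syndrome_simps)

lemma code_diff:
  assumes "c \<in> code" "d \<in> code"
  shows "c - d \<in> code"
proof -
  have "c - d = c + - d" using assms by (auto simp: code_def)
  then show ?thesis using assms by (simp add: code_def syndrome_simps)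
qed

lemma zero_in_code: "0\<^sub>v N \<in> code"
  by (simp add: code_def syndrome_def z4_embed_simps)

text \<open>Twice the Lee weight equals twice the first syndrome in the ring, so 4 divides twice the
  weight.\<close>

lemma even_lee_weight_code:
  assumes "c \<in> code"
  shows "even (lee_weight c)"
proof -
  have c: "dim_vec c = N" "syndrome (\<lambda>_. 1) c = 0" using assms by (auto simp: code_def)
  have "of_nat (2 * lee_weight c) = (\<Sum>j<N. 2 * of_nat (lee_weight_elem (c $ j)) :: 'r)"
    by (simp add: lee_weight_def c sum_distrib_left)
  also have "\<dots> = 2 * syndrome (\<lambda>_. 1) c"
    unfolding two_mult_lee_weight_elem by (simp add: syndrome_def sum_distrib_left)
  finally have "4 dvd 2 * lee_weight c"
    unfolding c of_nat_eq_0_iff_char_dvd[symmetric] char_4[symmetric] by simp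
  then show ?thesis by presburger
qed

text \<open>The all-one row forces two signed unit vectors to have opposite signs. The row g then
  forces equal positions, so they cancel.\<close>

lemma code_lee_weight_neq_2:
  assumes "c \<in> code"
  shows "lee_weight c \<noteq> 2"
proof
  assume w: "lee_weight c = 2"
  have c: "c \<in> carrier_vec N" using assms by (simp add: code_def)
  obtain c1 s i where 1: "c1 \<in> carrier_vec N" "i < N" "lee_weight c1 = 1" "c = signed_unit N s i + c1"
    using lee_weight_remove_signed_unit[OF c, of 1] w by auto
  obtain c2 t j where 2: "c2 \<in> carrier_vec N" "j < N" "lee_weight c2 = 0" "c1 = signed_unit N t j + c2"
    using lee_weight_remove_signed_unit[OF 1(1), of 0] 1 by auto
  have "c2 = 0\<^sub>v N" using 2 by (simp add: lee_weight_eq_0_iff)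
  then have e: "c = signed_unit N s i + signed_unit N t j" using 1 2 by simp
  have s: "(if s then 1 else - 1) + (if t then 1 else - 1) = (0::'r)"
    and g: "(if s then g i else - g i) + (if t then g j else - g j) = 0"
    using assms 1(2) 2(2) by (auto simp: code_def e syndrome_simps)
  have "s \<noteq> t" using s two_nonzero by (cases s; cases t) auto
  then have "g i = g j" using g by (cases s) (auto simp: algebra_simps)
  then have "i = j" using inj_mod2 1 2 by auto
  then have "c = 0\<^sub>v N" unfolding e using \<open>s \<noteq> t\<close> by (intro eq_vecI) (auto simp: signed_unit_def)
  then show False using w by (simp add: lee_weight_eq_0_iff[THEN iffD2])
qed

section \<open>Exclusion of weight 4\<close>

context
  assumes differences: "\<And>i j k l. i < N \<Longrightarrow> j < N \<Longrightarrow> k < N \<Longrightarrow> l < N \<Longrightarrow>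
      i \<noteq> j \<Longrightarrow> g i - g j = g k - g l \<Longrightarrow> i = k \<and> j = l"
    and sums: "\<And>i j k l. i < N \<Longrightarrow> j < N \<Longrightarrow> k < N \<Longrightarrow> l < N \<Longrightarrow>
      g i + g j + (g k + g l) = 0 \<Longrightarrow> i = j \<and> j = k \<and> k = l"
begin

lemma code_balanced_eq_0:
  assumes "c \<in> code" "i < N" "j < N" "k < N" "l < N"
    and c: "c = unit_vec N i + unit_vec N j + (- unit_vec N k + - unit_vec N l)"
  shows "c = 0\<^sub>v N"
proof -
  have g: "g i + g j = g k + g l"
    using assms(1-5) by (simp add: c code_def syndrome_simps algebra_simps)
  have "i = k \<and> j = l \<or> i = l \<and> j = k"
  proof (cases "i = k")
    case True
    then have "g j = g l" using g by simp
    then show ?thesis using True assms inj_mod2 by auto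
  next
    case False
    \<comment> \<open>Moving terms across pairs each positive index with a negative one, as
      \<open>differences\<close> requires.\<close>
    have "g i - g k = g l - g j" using g by (simp add: algebra_simps)
    then show ?thesis using differences[of i k l j] False assms by auto
  qed
  then show ?thesis unfolding c by (intro eq_vecI) auto
qed

text \<open>All four positions coincide, and four times a unit vector vanishes modulo 4.\<close>

lemma code_positive_eq_0:
  assumes "c \<in> code" "i < N" "j < N" "k < N" "l < N"
    and c: "c = unit_vec N i + unit_vec N j + (unit_vec N k + unit_vec N l)"
  shows "c = 0\<^sub>v N"
proof -
  have "g i + g j + (g k + g l) = 0"
    using assms(1-5) by (simp add: c code_def syndrome_simps)
  then have "i = j" "j = k" "k = l" using sums assms by blast+
  then show ?thesis unfolding c by (intro eq_vecI) (auto simp: unit_vec_def)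
qed

text \<open>Of the sixteen sign patterns of four unit vectors, the all-one row leaves the two
  constant ones and the six balanced ones. The all-negative pattern is handled by negating the
  word.\<close>

lemma code_lee_weight_neq_4:
  assumes "c \<in> code"
  shows "lee_weight c \<noteq> 4"
proof
  assume w: "lee_weight c = 4"
  have c: "c \<in> carrier_vec N" using assms by (simp add: code_def)
  obtain c1 s i where 1: "c1 \<in> carrier_vec N" "i < N" "lee_weight c1 = 3" "c = signed_unit N s i + c1"
    using lee_weight_remove_signed_unit[OF c, of 3] w by auto
  obtain c2 t j where 2: "c2 \<in> carrier_vec N" "j < N" "lee_weight c2 = 2" "c1 = signed_unit N t j + c2"
    using lee_weight_remove_signed_unit[OF 1(1), of 2] 1 by auto
  obtain c3 u k where 3: "c3 \<in> carrier_vec N" "k < N" "lee_weight c3 = 1" "c2 = signed_unit N u k + c3"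
    using lee_weight_remove_signed_unit[OF 2(1), of 1] 2 by auto
  obtain c4 v l where 4: "c4 \<in> carrier_vec N" "l < N" "lee_weight c4 = 0" "c3 = signed_unit N v l + c4"
    using lee_weight_remove_signed_unit[OF 3(1), of 0] 3 by auto
  note ijkl = 1(2) 2(2) 3(2) 4(2)
  have "c4 = 0\<^sub>v N" using 4 by (simp add: lee_weight_eq_0_iff)
  then have e: "c = signed_unit N s i + (signed_unit N t j + (signed_unit N u k + signed_unit N v l))"
    using 1 2 3 4 by simp
  have signs: "(if s then 1 else - 1) + ((if t then 1 else - 1) +
      ((if u then 1 else - 1) + (if v then 1 else - 1))) = (0::'r)"
    using assms ijkl by (simp add: code_def e syndrome_simps)
  have two: "- (2::'r) \<noteq> 0" using two_nonzero by simp
  have "c = 0\<^sub>v N \<or> - c = 0\<^sub>v N"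
  proof -
    have perm: "c = unit_vec N a + unit_vec N b + (- unit_vec N a' + - unit_vec N b') \<Longrightarrow> ?thesis"
      if "a < N" "b < N" "a' < N" "b' < N" for a b a' b'
      using code_balanced_eq_0[OF assms that] by blast
    note e' = e[unfolded signed_unit_def]
    show ?thesis
    proof (cases s; cases t; cases u; cases v)
      assume "s" "t" "u" "v"
      then show ?thesis
        using code_positive_eq_0[OF assms ijkl] e' by (auto simp: assoc_add_vec[of _ N])
    next
      assume "\<not> s" "\<not> t" "\<not> u" "\<not> v"
      then have "- c = unit_vec N i + unit_vec N j + (unit_vec N k + unit_vec N l)"
        unfolding e' by (intro eq_vecI) auto
      then show ?thesis using code_positive_eq_0[OF code_uminus[OF assms] ijkl] by blast
    next
      assume "s" "t" "\<not> u" "\<not> v"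
      then show ?thesis by (intro perm[of i j k l] ijkl) (unfold e', intro eq_vecI, auto)
    next
      assume "s" "\<not> t" "u" "\<not> v"
      then show ?thesis by (intro perm[of i k j l] ijkl) (unfold e', intro eq_vecI, auto)
    next
      assume "s" "\<not> t" "\<not> u" "v"
      then show ?thesis by (intro perm[of i l j k] ijkl) (unfold e', intro eq_vecI, auto)
    next
      assume "\<not> s" "t" "u" "\<not> v"
      then show ?thesis by (intro perm[of j k i l] ijkl) (unfold e', intro eq_vecI, auto)
    next
      assume "\<not> s" "t" "\<not> u" "v"
      then show ?thesis by (intro perm[of j l i k] ijkl) (unfold e', intro eq_vecI, auto)
    next
      assume "\<not> s" "\<not> t" "u" "v"
      then show ?thesis by (intro perm[of k l i j] ijkl) (unfold e', intro eq_vecI, auto)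
    \<comment> \<open>In the remaining patterns one sign differs from the other three, so the signs
      sum to 2 or -2, which is nonzero.\<close>
    qed (use signs two two_nonzero in simp_all)
  qed
  moreover have "lee_weight (0\<^sub>v N) = 0" by (simp add: lee_weight_eq_0_iff)
  ultimately have "lee_weight c = 0 \<or> lee_weight (- c) = 0" by metis
  then show False using w by (simp add: lee_weight_uminus)
qed

end

section \<open>Existence of words of small weight\<close>

lemma code_lee_weight_le_4:
  assumes ijkl: "i < N" "j < N" "k < N" "l < N" and "i \<noteq> j" "g i - g j = g k - g l" "\<not> (i = k \<and> j = l)"
  shows "\<exists>c\<in>code. c \<noteq> 0\<^sub>v N \<and> lee_weight c \<le> 4"
proof -
  define c :: "4 vec" where "c = unit_vec N i + unit_vec N l + - (unit_vec N j + unit_vec N k)"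
  \<comment> \<open>With i different from j and k, nothing is subtracted at position i, where the
    entry is 1, or 2 if l = i.\<close>
  have "i \<noteq> k"
  proof
    assume "i = k"
    then have "g j = g l" using assms by simp
    then show False using inj_mod2 \<open>i = k\<close> assms by auto
  qed
  then have "c $ i \<noteq> 0"
    using ijkl \<open>i \<noteq> j\<close> by (auto simp: c_def unit_vec_def)
  then have "c \<noteq> 0\<^sub>v N" using ijkl by auto
  moreover have "c \<in> code"
    using assms by (simp add: c_def code_def syndrome_simps algebra_simps)
  moreover have "lee_weight c \<le> 4"
  proof -
    have "lee_weight c \<le> lee_weight (unit_vec N i + unit_vec N l) + lee_weight (- (unit_vec N j + unit_vec N k))"
      unfolding c_def by (rule lee_weight_add_le) simp
    also have "\<dots> \<le> (lee_weight (unit_vec N i) + lee_weight (unit_vec N l)) +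
        (lee_weight (unit_vec N j) + lee_weight (unit_vec N k))"
      unfolding lee_weight_uminus by (intro add_mono lee_weight_add_le) simp_all
    finally show ?thesis using ijkl by (simp add: lee_weight_unit_vec)
  qed
  ultimately show ?thesis by blast
qed

text \<open>Three columns are added and their sum is rewritten as one column plus twice another. The
  difference satisfies both checks, as each side uses three unit vectors. It is nonzero because
  \<open>b\<close> has three nonzero entries and \<open>a\<close> at most two.\<close>

lemma code_lee_weight_le_6:
  assumes "N \<ge> 3" and surj: "\<And>r. \<exists>i<N. \<exists>j<N. r = g i + 2 * g j"
  shows "\<exists>c\<in>code. c \<noteq> 0\<^sub>v N \<and> lee_weight c \<le> 6"
proof -
  obtain i j where ij: "i < N" "j < N" "g 0 + (g 1 + g 2) = g i + 2 * g j" using surj by blast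
  define a :: "4 vec" where "a = unit_vec N i + (unit_vec N j + unit_vec N j)"
  define b :: "4 vec" where "b = unit_vec N 0 + (unit_vec N 1 + unit_vec N 2)"
  have N: "0 < N" "1 < N" "2 < N" using assms(1) by auto
  have ab: "a \<in> carrier_vec N" "b \<in> carrier_vec N" by (auto simp: a_def b_def)
  have "a + - b \<noteq> 0\<^sub>v N"
  proof
    assume z: "a + - b = 0\<^sub>v N"
    have "a $ m = 1" if "m < 3" for m
    proof -
      have "m < N" using that N by simp
      then have "(a + - b) $ m = 0" using z by simp
      then have "a $ m = b $ m" using ab \<open>m < N\<close> by simp
      also have "b $ m = 1" using that N by (auto simp: b_def unit_vec_def)
      finally show ?thesis .
    qed
    moreover have "a $ m = 0" if "m < N" "m \<noteq> i" "m \<noteq> j" for m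
      using that ij by (simp add: a_def)
    ultimately have "m = i \<or> m = j" if "m < 3" for m
      using that N by (metis less_le_trans assms(1) zero_neq_one)
    from this[of 0] this[of 1] this[of 2] show False by auto
  qed
  moreover have "a + - b \<in> code"
  proof -
    have "syndrome (\<lambda>_. 1) (a + - b) = 0"
      using ij(1,2) N ab by (simp add: syndrome_simps a_def b_def)
    moreover have "syndrome g (a + - b) = 0"
      using ij N ab by (simp add: syndrome_simps a_def b_def)
    ultimately show ?thesis using ab by (simp add: code_def)
  qed
  moreover have "lee_weight (a + - b) \<le> 6"
  proof -
    have le: "lee_weight (unit_vec N p + (unit_vec N q + unit_vec N r)) \<le> 3"
      if "p < N" "q < N" "r < N" for p q r
    proof -
      have "lee_weight (unit_vec N p + (unit_vec N q + unit_vec N r)) \<le>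
          lee_weight (unit_vec N p) + lee_weight (unit_vec N q + unit_vec N r)"
        by (rule lee_weight_add_le) simp
      moreover have "lee_weight (unit_vec N q + unit_vec N r) \<le>
          lee_weight (unit_vec N q) + lee_weight (unit_vec N r)"
        by (rule lee_weight_add_le) simp
      ultimately show ?thesis using that by (simp add: lee_weight_unit_vec)
    qed
    have "lee_weight (a + - b) \<le> lee_weight a + lee_weight (- b)"
      using ab by (intro lee_weight_add_le) simp
    moreover have "lee_weight a \<le> 3" "lee_weight b \<le> 3"
      using le ij N by (simp_all add: a_def b_def)
    ultimately show ?thesis by (simp add: lee_weight_uminus)
  qed
  ultimately show ?thesis by blast
qed

lemma min_lee_dist_code:
  "min_lee_dist code = Min (lee_weight ` (code - {0\<^sub>v N}))"
proof -
  have "{lee_dist u v | u v. u \<in> code \<and> v \<in> code \<and> u \<noteq> v} = lee_weight ` (code - {0\<^sub>v N})"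
  proof safe
    fix u v assume uv: "u \<in> code" "v \<in> code" "u \<noteq> v"
    have "u - v \<noteq> 0\<^sub>v N"
    proof
      assume z: "u - v = 0\<^sub>v N"
      have "u = v"
      proof (rule eq_vecI)
        fix m assume "m < dim_vec v"
        then have "m < N" using uv by (auto simp: code_def)
        then have "(u - v) $ m = 0" using z by simp
        then show "u $ m = v $ m" using \<open>m < dim_vec v\<close> by simp
      qed (use uv in \<open>auto simp: code_def\<close>)
      then show False using uv by simp
    qed
    then show "lee_dist u v \<in> lee_weight ` (code - {0\<^sub>v N})"
      using uv code_diff by (auto simp: lee_dist_def)
  next
    fix c assume "c \<in> code" "c \<noteq> 0\<^sub>v N"
    moreover have "lee_weight c = lee_dist c (0\<^sub>v N)"
      using \<open>c \<in> code\<close> by (simp add: lee_dist_def code_def)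
    ultimately show "\<exists>u v. lee_weight c = lee_dist u v \<and> u \<in> code \<and> v \<in> code \<and> u \<noteq> v"
      using zero_in_code by blast
  qed
  then show ?thesis by (simp add: min_lee_dist_def)
qed

lemma finite_lee_weights: "finite (lee_weight ` code)"
proof (rule finite_subset)
  have "lee_weight c \<le> 2 * N" if "c \<in> code" for c
  proof -
    have "lee_weight c \<le> (\<Sum>i<dim_vec c. 2)"
      unfolding lee_weight_def by (intro sum_mono) (simp add: lee_weight_elem_def)
    then show ?thesis using that by (auto simp: code_def)
  qed
  then show "lee_weight ` code \<subseteq> {..2 * N}" by auto
qed simp

text \<open>A weight that is even, positive, not 2 and at most 6 is 4 or 6. Here \<open>D\<close>
  will be planarity in terms of column indices: it rules out 4, and its failure produces a nonzero
  word of weight at most 4.\<close>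

lemma min_lee_dist_code_4_or_6:
  assumes N: "N \<ge> 3" and surj: "\<And>r. \<exists>i<N. \<exists>j<N. r = g i + 2 * g j"
    and D: "D \<longleftrightarrow> (\<forall>i<N. \<forall>j<N. \<forall>k<N. \<forall>l<N. i \<noteq> j \<longrightarrow> g i - g j = g k - g l \<longrightarrow> i = k \<and> j = l)"
    and sums: "\<And>i j k l. D \<Longrightarrow> i < N \<Longrightarrow> j < N \<Longrightarrow> k < N \<Longrightarrow> l < N \<Longrightarrow>
      g i + g j + (g k + g l) = 0 \<Longrightarrow> i = j \<and> j = k \<and> k = l"
  shows "min_lee_dist code \<in> {4, 6} \<and> (min_lee_dist code = 6 \<longleftrightarrow> D)"
proof -
  let ?W = "lee_weight ` (code - {0\<^sub>v N})"
  have fin: "finite ?W" using finite_lee_weights by (rule rev_finite_subset) auto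
  obtain c where c: "c \<in> code" "c \<noteq> 0\<^sub>v N" "lee_weight c \<le> 6"
    using code_lee_weight_le_6[OF N surj] by blast
  have ne: "?W \<noteq> {}" using c by blast
  have m: "Min ?W \<in> ?W" using Min_in[OF fin ne] .
  have weights: "even w \<and> w \<noteq> 0 \<and> w \<noteq> 2" if "w \<in> ?W" for w
    using that even_lee_weight_code code_lee_weight_neq_2
    by (auto simp: lee_weight_eq_0_iff code_def)
  have le6: "Min ?W \<le> 6" using Min_le[OF fin, of "lee_weight c"] c by auto
  have "w = 4 \<or> w = 6" if "even w" "w \<noteq> 0" "w \<noteq> 2" "w \<le> 6" for w :: nat
    using that by presburger
  then have "Min ?W \<in> {4, 6}" using weights[OF m] le6 by blast
  moreover have "Min ?W \<noteq> 4" if D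
  proof -
    have "lee_weight c \<noteq> 4" if "c \<in> code" for c
    proof (rule code_lee_weight_neq_4[OF _ _ that])
      show "i = k \<and> j = l" if "i < N" "j < N" "k < N" "l < N" "i \<noteq> j" "g i - g j = g k - g l" for i j k l
        using \<open>D\<close> that unfolding D by blast
    qed (use sums \<open>D\<close> in blast)
    then have "4 \<notin> ?W" by auto
    then show ?thesis using m by metis
  qed
  moreover have "Min ?W \<noteq> 6" if "\<not> D"
  proof -
    obtain i j k l where "i < N" "j < N" "k < N" "l < N"
      and "i \<noteq> j" "g i - g j = g k - g l" "\<not> (i = k \<and> j = l)"
      using \<open>\<not> D\<close> unfolding D by blast
    from code_lee_weight_le_4[OF this]
    obtain c where "c \<in> code" "c \<noteq> 0\<^sub>v N" "lee_weight c \<le> 4" by blast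
    then have "Min ?W \<le> 4" using Min_le[OF fin, of "lee_weight c"] by auto
    then show ?thesis by simp
  qed
  ultimately show ?thesis unfolding min_lee_dist_code by auto
qed

end

section \<open>The code of a function on the Teichmueller set\<close>

theorem theorem2p4:
  fixes n :: nat and G T :: "'r::{comm_ring_1,finite} set"
    and \<beta> :: 'r and f :: "'r \<Rightarrow> 'r"
  assumes "n \<ge> 3" and "odd n"
    and "galois_ring TYPE('r)" and "CHAR('r) = 4" and "CARD('r) = 4 ^ n"
    and "teich_group n G" and "T = insert 0 G"
    and "\<beta> \<in> G" and "cyclic_generator \<beta> G"
    and "f \<in> T \<rightarrow> T"
  shows "min_lee_dist (function_code n T \<beta> f) \<in> {4, 6} \<and>
         (min_lee_dist (function_code n T \<beta> f) = 6 \<longleftrightarrow> planar T f)"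
proof -
  interpret teichmueller n G T
    using assms by unfold_locales auto
  define N :: nat where "N = 2 ^ n"
  have "2 ^ 3 \<le> (2::nat) ^ n" using assms(1) by (intro power_increasing) auto
  then have N3: "N \<ge> 3" by (simp add: N_def)
  define t where "t = teich_point \<beta>"
  define g where "g = (\<lambda>j. column f (t j))"
  have im: "t ` {..<N} = T"
  proof -
    \<comment> \<open>Exponents can be reduced modulo N - 1 = 2 ^ n - 1. Together with index 0 for
      the element 0, the N columns exhaust \<open>T\<close>; equal cardinality then makes the
      indexing injective.\<close>
    have "\<beta> ^ i \<in> (\<lambda>i. \<beta> ^ i) ` {..<N - 1}" for i
    proof -
      have N1: "N - 1 > 0" using N3 by simp
      obtain \<gamma> where "\<beta> * \<gamma> = 1" using assms(6,8) by (auto simp: teich_group_def)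
      moreover have "\<beta> ^ N = \<beta>" using power_card_T[of \<beta>] assms(7,8) by (simp add: N_def)
      then have "\<beta> ^ (N - 1) * \<beta> = \<beta>" using N3 power_minus_mult[of N \<beta>] by simp
      ultimately have "\<beta> ^ (N - 1) = 1" by (metis mult.assoc mult.right_neutral)
      then have "\<beta> ^ i = \<beta> ^ (i mod (N - 1))"
        by (metis mult_div_mod_eq mult_1 power_add power_mult power_one)
      then show ?thesis using N1 by (intro image_eqI[of _ _ "i mod (N - 1)"]) auto
    qed
    then have "G = (\<lambda>i. \<beta> ^ i) ` {..<N - 1}"
      using assms(9) unfolding cyclic_generator_def by blast
    moreover have "{..<N} = insert 0 (Suc ` {..<N - 1})"
      using N3 by (simp flip: lessThan_Suc_eq_insert_0)
    ultimately show ?thesis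
      by (simp add: t_def teich_point_def image_image assms(7))
  qed
  have inj: "inj_on t {..<N}"
  proof (rule eq_card_imp_inj_on)
    show "card (t ` {..<N}) = card {..<N}" unfolding im by (simp add: card_T N_def)
  qed simp
  have tT: "t j \<in> T" if "j < N" for j using im that by auto
  have inj_g: "i = j" if "i < N" "j < N" "2 * g i = 2 * g j" for i j
    using that T_inj_mod2[OF tT tT] inj by (auto simp: g_def two_mult_column dest: inj_onD)
  interpret z4_parity_check N g
    using assms(4) inj_g by unfold_locales auto
  have code: "function_code n T \<beta> f = code"
  proof -
    have "c \<in> function_code n T \<beta> f \<longleftrightarrow> c \<in> code" for c
    proof (cases "c \<in> carrier_vec N")
      case True
      define H where "H = parity_check_matrix n T \<beta> f"
      have H: "dim_row H = 2" "dim_col H = N" by (simp_all add: H_def parity_check_matrix_def N_def)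
      have "(H *\<^sub>v map_vec z4_embed c) $ 0 = syndrome (\<lambda>_. 1) c"
        using True unfolding syndrome_def
        by (auto simp: H_def parity_check_matrix_def scalar_prod_def
            N_def lessThan_atLeast0 intro!: sum.cong)
      moreover have "(H *\<^sub>v map_vec z4_embed c) $ 1 = syndrome g c"
        using True unfolding syndrome_def
        by (auto simp: H_def parity_check_matrix_def scalar_prod_def
            N_def lessThan_atLeast0 g_def t_def column_def mult.commute intro!: sum.cong)
      ultimately show ?thesis
        using True by (auto simp: function_code_def code_of_parity_check_def code_def H
            vec_eq_iff less_2_cases_iff simp flip: H_def)
    next
      case False
      then show ?thesis unfolding code_def
        by (auto simp: function_code_def code_of_parity_check_def parity_check_matrix_def N_def)
    qed
    then show ?thesis by blast
  qed
  have planar: "planar T f \<longleftrightarrow> (\<forall>i<N. \<forall>j<N. \<forall>k<N. \<forall>l<N. i \<noteq> j \<longrightarrow> g i - g j = g k - g l \<longrightarrow> i = k \<and> j = l)"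
  proof -
    have t_eq: "t i = t j \<longleftrightarrow> i = j" if "i \<in> {..<N}" "j \<in> {..<N}" for i j
      using inj that by (auto dest: inj_onD)
    have ball_T: "(\<forall>x\<in>T. P x) \<longleftrightarrow> (\<forall>i\<in>{..<N}. P (t i))" for P
      unfolding im[symmetric] by simp
    have "planar T f \<longleftrightarrow> (\<forall>i\<in>{..<N}. \<forall>j\<in>{..<N}. \<forall>k\<in>{..<N}. \<forall>l\<in>{..<N}.
        t i \<noteq> t j \<longrightarrow> g i - g j = g k - g l \<longrightarrow> t i = t k \<and> t j = t l)"
      unfolding planar_iff_column_diff[OF assms(10)] by (simp only: ball_T g_def)
    also have "\<dots> \<longleftrightarrow> (\<forall>i\<in>{..<N}. \<forall>j\<in>{..<N}. \<forall>k\<in>{..<N}. \<forall>l\<in>{..<N}.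
        i \<noteq> j \<longrightarrow> g i - g j = g k - g l \<longrightarrow> i = k \<and> j = l)"
      by (intro ball_cong refl) (simp only: t_eq)
    finally show ?thesis by (simp only: Ball_def lessThan_iff)
  qed
  show ?thesis unfolding code
  proof (rule min_lee_dist_code_4_or_6)
    show "N \<ge> 3" by (rule N3)
    show "\<exists>i<N. \<exists>j<N. r = g i + 2 * g j" for r
    proof -
      obtain a b where ab: "a \<in> T" "r = a + 2 * b" by (rule teich_decomposition)
      \<comment> \<open>The column at a already contributes twice the root of f a. The second column
        must therefore represent b minus that root modulo 2.\<close>
      obtain a' b' where ab': "a' \<in> T" "b - teich_sqrt T (f a) = a' + 2 * b'" by (rule teich_decomposition)
      obtain i j where ij: "i < N" "j < N" "a = t i" "a' = t j" using ab(1) ab'(1) im by blast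
      have "2 * (b - teich_sqrt T (f a)) = 2 * a'" unfolding ab' by (simp add: distrib_left)
      then have "r = g i + 2 * g j"
        unfolding g_def two_mult_column ij(3,4)[symmetric] by (simp add: column_def ab(2) algebra_simps)
      then show ?thesis using ij by blast
    qed
    show "i = j \<and> j = k \<and> k = l" if "planar T f" "i < N" "j < N" "k < N" "l < N"
      "g i + g j + (g k + g l) = 0" for i j k l
    proof (rule sum_four_eq_0_if_differences[of "{..<N}" g])
      show "i = k \<and> j = l" if "i \<in> {..<N}" "j \<in> {..<N}" "k \<in> {..<N}" "l \<in> {..<N}"
        "i \<noteq> j" "g i - g j = g k - g l" for i j k l
        using \<open>planar T f\<close> that unfolding planar by blast
      show "card {..<N} = 2 ^ n" unfolding N_def by simp
    qed (use that inj_g assms(2) in simp_all)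
  qed (rule planar)
qed

end
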